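(* Let $q$ be a power of an odd prime $p$ and $K$ an algebraic closure of $\mathbb{F}_q$. Let $\mathrm{PGL}(2,q)$ denote the subgroup of $\mathrm{PGL}(3,q)$ generated by $\tau:(X,Y,Z)\mapsto(Z,Y,X)$, $\sigma_a:(X,Y,Z)\mapsto(X+aY+\tfrac12a^2Z,\,Y+aZ,\,Z)$ for $a\in\mathbb{F}_q$, and $\delta_b:(X,Y,Z)\mapsto(b^2X,bY,Z)$ for $b\in\mathbb{F}_q^*$, acting on $\mathrm{PG}(2,K)$. Then $d(\mathrm{PGL}(2,q))=2$, $\varepsilon(\mathrm{PGL}(2,q))=q-1$, and the irreducible conic $Y^2-2XZ=0$ is the unique $\mathrm{PGL}(2,q)$-invariant irreducible plane curve of degree smaller than $q+1$.
   Context: This group is the stabilizer in $\mathrm{PGL}(3,q)$ of the conic $Y^2-2XZ=0$. Plane curves are over $K$; irreducible means irreducible over $K$; $G$-invariant means mapped onto itself by every element of $G$. $d(G)$ is the smallest degree of a $G$-invariant irreducible plane curve other than a line; $\varepsilon(G)=d'(G)-d(G)$ where $d'(G)$ is the smallest degree larger than $d(G)$ of a $G$-invariant irreducible plane curve. *)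

theory Defs
  imports "HOL-Computational_Algebra.Computational_Algebra"
begin

text \<open>Homogeneous polynomials in K[X,Y,Z] are represented as elements of the
  nested polynomial ring  K[X][Y][Z] = 'a poly poly poly  (outermost variable Z,
  middle variable Y, innermost variable X).\<close>

type_synonym 'a pol3 = "'a poly poly poly"

definition constP :: "'a::comm_ring_1 \<Rightarrow> 'a pol3" where
  "constP a = [:[:[:a:]:]:]"

definition varX :: "'a::comm_ring_1 pol3" where "varX = [:[:[:0, 1:]:]:]"
definition varY :: "'a::comm_ring_1 pol3" where "varY = [:[:0, 1:]:]"
definition varZ :: "'a::comm_ring_1 pol3" where "varZ = [:0, 1:]"

definition coeff3 :: "'a::comm_ring_1 pol3 \<Rightarrow> nat \<Rightarrow> nat \<Rightarrow> nat \<Rightarrow> 'a" where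
  "coeff3 F i j k = coeff (coeff (coeff F k) j) i"

definition homog_of_deg :: "'a::comm_ring_1 pol3 \<Rightarrow> nat \<Rightarrow> bool" where
  "homog_of_deg F d \<longleftrightarrow> F \<noteq> 0 \<and> (\<forall>i j k. coeff3 F i j k \<noteq> 0 \<longrightarrow> i + j + k = d)"

definition eval3 :: "'a::comm_ring_1 pol3 \<Rightarrow> 'a pol3 \<Rightarrow> 'a pol3 \<Rightarrow> 'a pol3 \<Rightarrow> 'a pol3" where
  "eval3 F A B C =
     poly (map_poly (\<lambda>G. poly (map_poly (\<lambda>H. poly (map_poly constP H) A) G) B) F) C"

text \<open>A projective linear map is represented by the triple of linear forms
  (X',Y',Z') giving the images of the coordinates; a curve F = 0 is mapped to
  itself by it iff F(X',Y',Z') is a nonzero scalar multiple of F.\<close>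

type_synonym 'a lin3 = "'a pol3 \<times> 'a pol3 \<times> 'a pol3"

definition comp3 :: "'a::comm_ring_1 lin3 \<Rightarrow> 'a lin3 \<Rightarrow> 'a lin3" where
  "comp3 g h = (case g of (g1, g2, g3) \<Rightarrow> case h of (h1, h2, h3) \<Rightarrow>
      (eval3 g1 h1 h2 h3, eval3 g2 h1 h2 h3, eval3 g3 h1 h2 h3))"

definition tau :: "'a::comm_ring_1 lin3" where
  "tau = (varZ, varY, varX)"

definition sigma :: "'a::field \<Rightarrow> 'a lin3" where
  "sigma a = (varX + constP a * varY + constP (a^2 / 2) * varZ, varY + constP a * varZ, varZ)"

definition delta :: "'a::field \<Rightarrow> 'a lin3" where
  "delta b = (constP (b^2) * varX, constP b * varY, varZ)"

definition Fq :: "nat \<Rightarrow> 'a::field set" where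
  "Fq q = {x. x ^ q = x}"

text \<open>The subgroup PGL(2,q) of PGL(3,q) generated by tau, sigma_a, delta_b.
  Since every generator has its inverse among the generators
  (tau^-1 = tau, sigma_a^-1 = sigma_(-a), delta_b^-1 = delta_(1/b)), closure under
  identity and composition gives the generated group.\<close>
inductive_set PGL2 :: "nat \<Rightarrow> 'a::field lin3 set" for q where
  ident: "(varX, varY, varZ) \<in> PGL2 q"
| gen_tau: "tau \<in> PGL2 q"
| gen_sigma: "a \<in> Fq q \<Longrightarrow> sigma a \<in> PGL2 q"
| gen_delta: "b \<in> Fq q \<Longrightarrow> b \<noteq> 0 \<Longrightarrow> delta b \<in> PGL2 q"
| comp: "g \<in> PGL2 q \<Longrightarrow> h \<in> PGL2 q \<Longrightarrow> comp3 g h \<in> PGL2 q"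

definition invariant :: "nat \<Rightarrow> 'a::field pol3 \<Rightarrow> bool" where
  "invariant q F \<longleftrightarrow> (\<forall>g \<in> PGL2 q. \<exists>c. c \<noteq> 0 \<and>
      (case g of (g1, g2, g3) \<Rightarrow> eval3 F g1 g2 g3 = constP c * F))"

definition has_inv_irr_curve :: "nat \<Rightarrow> 'a::field itself \<Rightarrow> nat \<Rightarrow> bool" where
  "has_inv_irr_curve q T d \<longleftrightarrow>
     (\<exists>F :: 'a pol3. homog_of_deg F d \<and> irreducible F \<and> invariant q F)"

definition dG :: "nat \<Rightarrow> 'a::field itself \<Rightarrow> nat" where
  "dG q T = (LEAST d. d \<ge> 2 \<and> has_inv_irr_curve q T d)"

definition d'G :: "nat \<Rightarrow> 'a::field itself \<Rightarrow> nat" where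
  "d'G q T = (LEAST d. d > dG q T \<and> has_inv_irr_curve q T d)"

definition epsG :: "nat \<Rightarrow> 'a::field itself \<Rightarrow> nat" where
  "epsG q T = d'G q T - dG q T"

definition conic :: "'a::field pol3" where
  "conic = varY ^ 2 - constP 2 * varX * varZ"

end

theory Submission
  imports Defs
begin

text \<open>Restrict an invariant form F of degree d \<le> q to the conic, parametrized by
  (u^2/2, u, 1), obtaining a polynomial f(u) of degree at most 2d. If f = 0, the conic
  divides F. Otherwise invariance under the translations u \<mapsto> u + a with a in
  GF(q) makes f a polynomial in w = u^q - u, so f = \<alpha> w^2 + \<beta> w + \<gamma>, while
  \<tau> exchanges the coefficients of u^j and u^(2d-j) up to nonzero factors.

  If \<gamma> = 0, the curve meets the conic at (0,0,1); a unipotent stabilizer of that point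
  forces multiplicity at least two, so \<beta> = 0 and f = \<alpha> w^2 has degree
  2q = 2d, contradicting the vanishing of its constant term. If \<gamma> \<noteq> 0, then f has
  degree 2d, hence d = q and \<alpha> \<noteq> 0, and the maps u \<mapsto> bu force b^2 = 1 for all
  nonzero b in GF(q), so q = 3; in this remaining case \<tau> acts on F with the sign
  -1, so F vanishes on the line X = Z.

  In degree q + 1 the curve Y^(q+1) - X^q Z - X Z^q is invariant, being the pairing of a
  point with its Frobenius image under the polar form of the conic; as a polynomial
  in Z it is irreducible by Eisenstein's criterion (in reversed form) at the prime X.\<close>

section \<open>Substitution into ternary polynomials\<close>

text \<open>A predicate on plain functions lets coefficient embeddings, evaluations and
  \<open>pcompose\<close> be combined freely under one set of rules.\<close>

definition unital_hom :: "('a::comm_ring_1 \<Rightarrow> 'b::comm_ring_1) \<Rightarrow> bool" where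
  "unital_hom h \<longleftrightarrow> h 0 = 0 \<and> h 1 = 1 \<and> (\<forall>x y. h (x + y) = h x + h y) \<and> (\<forall>x y. h (x * y) = h x * h y)"

lemma unital_homD:
  assumes "unital_hom h"
  shows "h 0 = 0" "h 1 = 1" "h (x + y) = h x + h y" "h (x * y) = h x * h y"
    "h (- x) = - h x" "h (x - y) = h x - h y" "h (x ^ n) = h x ^ n"
proof -
  show *: "h 0 = 0" "h 1 = 1" "h (x + y) = h x + h y" "h (x * y) = h x * h y" for x y
    using assms by (auto simp: unital_hom_def)
  show m: "h (- x) = - h x" for x
    using *(3)[of x "- x"] *(1) by (simp add: eq_neg_iff_add_eq_0 add.commute)
  show "h (x - y) = h x - h y"
    using *(3)[of x "- y"] m by simp
  show "h (x ^ n) = h x ^ n"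
    by (induction n) (simp_all add: *)
qed

lemma unital_hom_poly_map:
  assumes h: "unital_hom h"
  shows "unital_hom (\<lambda>p. poly (map_poly h p) x)"
proof -
  note [simp] = unital_homD(1-4)[OF h]
  have pC: "poly (map_poly h (pCons a p)) x = h a + x * poly (map_poly h p) x" for a p
    by (simp add: map_poly_pCons)
  have add: "poly (map_poly h (p + q)) x = poly (map_poly h p) x + poly (map_poly h q) x" for p q
    by (induction p q rule: poly_induct2) (simp_all add: pC algebra_simps)
  have smult: "poly (map_poly h (smult a p)) x = h a * poly (map_poly h p) x" for a p
    by (induction p) (simp_all add: pC algebra_simps)
  have "poly (map_poly h (p * q)) x = poly (map_poly h p) x * poly (map_poly h q) x" for p q
    by (induction p) (simp_all add: pC add smult algebra_simps)
  then show ?thesis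
    by (simp add: unital_hom_def add)
qed

text \<open>The summation bound is \<open>degree p\<close>, although \<open>map_poly h\<close> may
  lower the degree: the additional terms vanish.\<close>

lemma poly_map_poly_sum:
  assumes "h 0 = (0 :: 'b::comm_ring_1)"
  shows "poly (map_poly h p) x = (\<Sum>i\<le>degree p. h (coeff p i) * x ^ i)"
proof -
  have "degree (map_poly h p) \<le> degree p"
    by (intro degree_le) (simp add: assms coeff_map_poly coeff_eq_0)
  then show ?thesis
    unfolding poly_altdef using assms
    by (intro sum.mono_neutral_cong_left) (auto simp: coeff_map_poly intro!: le_degree)
qed

text \<open>This is \<open>eval3\<close> with values in an arbitrary ring: the same substitution
  then serves points over K, parametrized curves over K[u] and forms in K[X,Y,Z].\<close>

definition ev :: "('a::comm_ring_1 \<Rightarrow> 'b::comm_ring_1) \<Rightarrow> 'a pol3 \<Rightarrow> 'b \<Rightarrow> 'b \<Rightarrow> 'b \<Rightarrow> 'b" where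
  "ev h F A B C =
     poly (map_poly (\<lambda>G. poly (map_poly (\<lambda>H. poly (map_poly h H) A) G) B) F) C"

lemma eval3_ev: "eval3 = ev constP"
  by (simp add: fun_eq_iff eval3_def ev_def)

lemma unital_hom_ev: "unital_hom h \<Longrightarrow> unital_hom (\<lambda>F. ev h F A B C)"
  unfolding ev_def by (intro unital_hom_poly_map)

lemma unital_hom_const: "unital_hom (\<lambda>a. [:a:])"
  by (simp add: unital_hom_def one_pCons)

lemma unital_hom_constP: "unital_hom constP"
  by (simp add: unital_hom_def constP_def one_pCons)

lemma unital_hom_pcompose: "unital_hom (\<lambda>p. pcompose p r)"
  by (simp add: unital_hom_def pcompose_add pcompose_mult one_pCons)

lemma unital_hom_poly: "unital_hom (\<lambda>p. poly p x)"
  by (simp add: unital_hom_def)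

lemmas constP_hom = unital_homD[OF unital_hom_constP]

lemma ev_gens:
  assumes "unital_hom h"
  shows "ev h (constP a) A B C = h a" "ev h varX A B C = A" "ev h varY A B C = B"
    "ev h varZ A B C = C"
  by (simp_all add: ev_def constP_def varX_def varY_def varZ_def map_poly_pCons unital_homD[OF assms])

lemmas ev_hom = unital_homD[OF unital_hom_ev]

text \<open>Constants and the three variables generate K[X,Y,Z] as a ring; peeling off one
  \<open>pCons\<close> at each nesting level shows it. Identities between ring homomorphisms thus
  need checking only on generators.\<close>

lemma pol3_induct:
  assumes c: "\<And>a. P (constP a)" and X: "P varX" and Y: "P varY" and Z: "P varZ"
    and add: "\<And>G H. P G \<Longrightarrow> P H \<Longrightarrow> P (G + H)"
    and mult: "\<And>G H. P G \<Longrightarrow> P H \<Longrightarrow> P (G * H)"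
  shows "P (F :: 'a::comm_ring_1 pol3)"
proof -
  have 1: "P [:[:p:]:]" for p :: "'a poly"
  proof (induction p)
    case 0
    then show ?case using c[of 0] by (simp add: constP_def)
  next
    case (pCons a p)
    have "[:[:pCons a p:]:] = constP a + varX * [:[:p:]:]"
      by (simp add: constP_def varX_def)
    then show ?case using add[OF c[of a] mult[OF X pCons(2)]] by (simp only:)
  qed
  have 2: "P [:G:]" for G :: "'a poly poly"
  proof (induction G)
    case 0
    then show ?case using c[of 0] by (simp add: constP_def)
  next
    case (pCons a p)
    have "[:pCons a p:] = [:[:a:]:] + varY * [:p:]"
      by (simp add: varY_def)
    then show ?case using add[OF 1[of a] mult[OF Y pCons(2)]] by (simp only:)
  qed
  show ?thesis
  proof (induction F)
    case 0
    then show ?case using c[of 0] by (simp add: constP_def)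
  next
    case (pCons a p)
    have "pCons a p = [:a:] + varZ * p"
      by (simp add: varZ_def)
    then show ?case using add[OF 2[of a] mult[OF Z pCons(2)]] by (simp only:)
  qed
qed

lemma hom_ev:
  assumes h: "unital_hom h" and g: "unital_hom g"
  shows "g (ev h F A B C) = ev (\<lambda>a. g (h a)) F (g A) (g B) (g C)"
proof -
  have gh: "unital_hom (\<lambda>a. g (h a))"
    using h g by (simp add: unital_hom_def)
  show ?thesis
    by (induction F rule: pol3_induct)
      (simp_all add: ev_gens[OF h] ev_gens[OF gh] ev_hom[OF h] ev_hom[OF gh] unital_homD[OF g])
qed

lemma ev_eval3:
  assumes h: "unital_hom h"
  shows "ev h (eval3 F g1 g2 g3) A B C = ev h F (ev h g1 A B C) (ev h g2 A B C) (ev h g3 A B C)"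
  using hom_ev[OF unital_hom_constP unital_hom_ev[OF h], where F = F and A1 = A and B1 = B and C1 = C]
  by (simp add: eval3_ev ev_gens[OF h])

lemma ev_id: "eval3 F varX varY varZ = F"
  by (induction F rule: pol3_induct)
    (simp_all add: eval3_ev ev_gens[OF unital_hom_constP] ev_hom[OF unital_hom_constP])

text \<open>Used modulo the conic, where 2XZ may be replaced by Y^2, and modulo Z - X.\<close>

lemma ev_cong_mod:
  assumes h: "unital_hom h" and "m dvd A - A'" "m dvd B - B'" "m dvd C - C'"
  shows "m dvd ev h F A B C - ev h F A' B' C'"
proof (induction F rule: pol3_induct)
  case (6 G H)
  have "ev h (G * H) A B C - ev h (G * H) A' B' C' =
      (ev h G A B C - ev h G A' B' C') * ev h H A B C
      + ev h G A' B' C' * (ev h H A B C - ev h H A' B' C')"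
    by (simp add: ev_hom[OF h] algebra_simps)
  with 6 show ?case by simp
next
  case (5 G H)
  have "ev h (G + H) A B C - ev h (G + H) A' B' C' =
      (ev h G A B C - ev h G A' B' C') + (ev h H A B C - ev h H A' B' C')"
    by (simp add: ev_hom[OF h] algebra_simps)
  with 5 show ?case by (metis dvd_add)
qed (use assms in \<open>simp_all add: ev_gens[OF h]\<close>)

text \<open>The chain rule at u = 0: \<open>Dx\<close>, \<open>Dy\<close>, \<open>Dz\<close> are the
  partial derivatives of F at (x,y,z), and only their existence is needed.\<close>

lemma ev_linear_part:
  fixes F :: "'a::comm_ring_1 pol3"
  shows "\<exists>Dx Dy Dz. \<forall>A B C. coeff A 0 = x \<longrightarrow> coeff B 0 = y \<longrightarrow> coeff C 0 = z \<longrightarrow>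
    coeff (ev (\<lambda>a. [:a:]) F A B C) 1 = coeff A 1 * Dx + coeff B 1 * Dy + coeff C 1 * Dz"
proof (induction F rule: pol3_induct)
  note k = unital_hom_const[where 'a = 'a]
  {
    case (1 a)
    show ?case by (rule exI[of _ 0])+ (simp add: ev_gens[OF k])
  next
    case 2
    show ?case by (rule exI[of _ 1], (rule exI[of _ 0])+) (simp add: ev_gens[OF k])
  next
    case 3
    show ?case by (rule exI[of _ 0], rule exI[of _ 1], rule exI[of _ 0]) (simp add: ev_gens[OF k])
  next
    case 4
    show ?case by (rule exI[of _ 0], rule exI[of _ 0], rule exI[of _ 1]) (simp add: ev_gens[OF k])
  next
    case (5 G H)
    then obtain Gx Gy Gz Hx Hy Hz where
      "\<forall>A B C. coeff A 0 = x \<longrightarrow> coeff B 0 = y \<longrightarrow> coeff C 0 = z \<longrightarrow>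
        coeff (ev (\<lambda>a. [:a:]) G A B C) 1 = coeff A 1 * Gx + coeff B 1 * Gy + coeff C 1 * Gz"
      "\<forall>A B C. coeff A 0 = x \<longrightarrow> coeff B 0 = y \<longrightarrow> coeff C 0 = z \<longrightarrow>
        coeff (ev (\<lambda>a. [:a:]) H A B C) 1 = coeff A 1 * Hx + coeff B 1 * Hy + coeff C 1 * Hz"
      by blast
    then show ?case
      by (intro exI[of _ "Gx + Hx"] exI[of _ "Gy + Hy"] exI[of _ "Gz + Hz"])
        (simp add: ev_hom[OF k] algebra_simps)
  next
    case (6 G H)
    then obtain Gx Gy Gz Hx Hy Hz where D:
      "\<forall>A B C. coeff A 0 = x \<longrightarrow> coeff B 0 = y \<longrightarrow> coeff C 0 = z \<longrightarrow>
        coeff (ev (\<lambda>a. [:a:]) G A B C) 1 = coeff A 1 * Gx + coeff B 1 * Gy + coeff C 1 * Gz"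
      "\<forall>A B C. coeff A 0 = x \<longrightarrow> coeff B 0 = y \<longrightarrow> coeff C 0 = z \<longrightarrow>
        coeff (ev (\<lambda>a. [:a:]) H A B C) 1 = coeff A 1 * Hx + coeff B 1 * Hy + coeff C 1 * Hz"
      by blast
    have 0: "coeff (ev (\<lambda>a. [:a:]) K A B C) 0 = ev (\<lambda>a. a) K x y z"
      if "coeff A 0 = x" "coeff B 0 = y" "coeff C 0 = z" for K and A B C :: "'a poly"
      using hom_ev[OF k unital_hom_poly[of 0], of K A B C] that by (simp add: poly_0_coeff_0)
    let ?g = "ev (\<lambda>a. a) G x y z" and ?h = "ev (\<lambda>a. a) H x y z"
    have "coeff (p * r) 1 = coeff p 0 * coeff r 1 + coeff p 1 * coeff r 0" for p r :: "'a poly"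
      by (simp add: coeff_mult)
    with D show ?case
      by (intro exI[of _ "?g * Hx + Gx * ?h"] exI[of _ "?g * Hy + Gy * ?h"] exI[of _ "?g * Hz + Gz * ?h"])
        (simp add: ev_hom[OF k] 0 algebra_simps)
  }
qed

text \<open>Reduces claims that are additive in F to monomials of degree d. Partial sums need not be
  homogeneous in the strict sense, since they may vanish, so Q alone is carried along.\<close>

lemma homog_induct [consumes 1, case_names zero add monom]:
  assumes F: "homog_of_deg F d" and zero: "Q 0"
    and add: "\<And>G H. Q G \<Longrightarrow> Q H \<Longrightarrow> Q (G + H)"
    and mon: "\<And>c i j k. i + j + k = d \<Longrightarrow> Q (constP c * varX ^ i * varY ^ j * varZ ^ k)"
  shows "Q (F :: 'a::comm_ring_1 pol3)"
proof -
  have sum: "Q (sum g A)" if "finite A" "\<And>x. x \<in> A \<Longrightarrow> Q (g x)" for g and A :: "nat set"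
    using that by (induction A rule: finite_induct) (auto intro: zero add)
  have "Q (\<Sum>k\<le>degree F. (\<Sum>j\<le>degree (coeff F k). (\<Sum>i\<le>degree (coeff (coeff F k) j).
      constP (coeff3 F i j k) * varX ^ i * varY ^ j * varZ ^ k)))"
  proof (intro sum finite_atMost)
    fix i j k
    show "Q (constP (coeff3 F i j k) * varX ^ i * varY ^ j * varZ ^ k)"
    proof (cases "coeff3 F i j k = 0")
      \<comment> \<open>The triple sum also runs over exponents of the wrong total degree; their
        coefficients are zero.\<close>
      case True
      then show ?thesis using zero by (simp add: constP_def)
    next
      case False
      then show ?thesis using F mon by (auto simp: homog_of_deg_def)
    qed
  qed
  also have "(\<Sum>k\<le>degree F. (\<Sum>j\<le>degree (coeff F k). (\<Sum>i\<le>degree (coeff (coeff F k) j).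
      constP (coeff3 F i j k) * varX ^ i * varY ^ j * varZ ^ k))) = eval3 F varX varY varZ"
    by (simp add: eval3_def poly_map_poly_sum coeff3_def constP_hom sum_distrib_right)
  finally show ?thesis by (simp add: ev_id)
qed

lemma ev_monomial:
  "unital_hom h \<Longrightarrow> ev h (constP c * varX ^ i * varY ^ j * varZ ^ k) A B C = h c * A ^ i * B ^ j * C ^ k"
  by (simp add: ev_hom ev_gens)

lemma ev_homog:
  assumes h: "unital_hom h" and F: "homog_of_deg F d"
  shows "ev h F (s * A) (s * B) (s * C) = s ^ d * ev h F A B C"
  using F
proof (induction rule: homog_induct)
  case (monom c i j k)
  then show ?case
    unfolding ev_monomial[OF h] monom[symmetric] by (simp add: power_mult_distrib power_add mult_ac)
qed (simp_all add: ev_hom[OF h] algebra_simps)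

section \<open>Restriction to the conic\<close>

text \<open>The affine parametrization misses only the point (1,0,0), at u = infinity; for a form of
  degree d its value there is, up to a power of 2, the coefficient of u^(2d).\<close>

definition restr :: "'a::field pol3 \<Rightarrow> 'a poly" where
  "restr F = ev (\<lambda>a. [:a:]) F [:0, 0, 1 / 2:] [:0, 1:] 1"

lemma restr_hom: "unital_hom restr"
  unfolding restr_def by (rule unital_hom_ev[OF unital_hom_const])

lemma restr_monomial:
  "restr (constP c * varX ^ i * varY ^ j * varZ ^ k) = monom (c * (1 / 2) ^ i) (2 * i + j)"
proof -
  have "[:0, 0, 1 / 2 :: 'a:] = monom (1 / 2) 2" "[:0, 1 :: 'a:] = monom 1 1"
    by (simp_all add: monom_altdef power2_eq_square)
  then show ?thesis
    unfolding restr_def ev_monomial[OF unital_hom_const]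
    by (simp add: monom_power mult_monom smult_monom)
qed

lemma degree_restr:
  assumes "homog_of_deg F d"
  shows "degree (restr F) \<le> 2 * d"
  using assms
proof (induction rule: homog_induct)
  case (monom c i j k)
  show ?case unfolding restr_monomial
    by (rule order.trans[OF degree_monom_le]) (use monom in simp)
qed (simp_all add: unital_homD[OF restr_hom] degree_add_le)

text \<open>The right-hand side is \<^term>\<open>restr F\<close> homogenized to degree 2d and taken at
  the parameter u = s/t.\<close>

lemma ev_conic_point:
  assumes h: "unital_hom h" and F: "homog_of_deg F d"
  shows "ev h F (h (1 / 2) * s ^ 2) (s * t) (t ^ 2) =
    (\<Sum>m\<le>2 * d. h (coeff (restr F) m) * s ^ m * t ^ (2 * d - m))"
  using F
proof (induction rule: homog_induct)
  case (monom c i j k)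
  have 1: "2 * i + j \<in> {..2 * d}" and 2: "2 * d - (2 * i + j) = j + 2 * k"
    using monom by auto
  have "(\<Sum>m\<le>2 * d. h (coeff (restr (constP c * varX ^ i * varY ^ j * varZ ^ k)) m) * s ^ m * t ^ (2 * d - m))
    = (\<Sum>m\<le>2 * d. if m = 2 * i + j then h (c * (1 / 2) ^ i) * s ^ m * t ^ (2 * d - m) else 0)"
    by (intro sum.cong) (auto simp: restr_monomial unital_homD[OF h])
  also have "\<dots> = h (c * (1 / 2) ^ i) * s ^ (2 * i + j) * t ^ (j + 2 * k)"
    unfolding sum.delta[OF finite_atMost] using 1 2 by simp
  also have "\<dots> = h c * (h (1 / 2) * s ^ 2) ^ i * (s * t) ^ j * (t ^ 2) ^ k"
    by (simp add: unital_homD(4,7)[OF h] power_mult_distrib power_add mult_ac flip: power_mult)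
  finally show ?case
    unfolding ev_monomial[OF h] by (rule sym)
qed (simp_all add: ev_hom[OF h] unital_homD[OF restr_hom] unital_homD[OF h] sum.distrib algebra_simps)

section \<open>Prime elements, Eisenstein's criterion and divisibility by the conic\<close>

lemma prime_elem_X: "prime_elem [:0, 1 :: 'a::field:]"
proof -
  have "[:0, 1:] dvd p \<longleftrightarrow> poly p 0 = 0" for p :: "'a poly"
    using poly_eq_0_iff_dvd[of p 0] by simp
  then show ?thesis by (intro prime_elemI) (auto simp: is_unit_poly_iff)
qed

lemma prime_elem_varX: "prime_elem (varX :: 'a::field pol3)"
  unfolding varX_def by (intro lift_prime_elem_poly prime_elem_X)

lemma dvd_prime_elem_power_cancel:
  fixes x m F :: "'a::idom"
  assumes x: "prime_elem x" and nd: "\<not> x dvd m" and "m dvd x ^ n * F"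
  shows "m dvd F"
  using assms(3)
proof (induction n)
  case (Suc n)
  from Suc(2) obtain Q where "x ^ Suc n * F = m * Q" by (rule dvdE)
  then have Q: "x * (x ^ n * F) = m * Q" by (simp add: mult.assoc)
  then have "x dvd m * Q"
    by (metis dvd_triv_left)
  with x nd have "x dvd Q"
    by (simp add: prime_elem_dvd_mult_iff)
  then obtain R where "Q = x * R" by blast
  with Q have "x * (x ^ n * F) = x * (m * R)"
    by (simp add: mult_ac)
  moreover have "x \<noteq> 0" using x by auto
  ultimately have "x ^ n * F = m * R" by simp
  with Suc show ?case by simp
qed simp

text \<open>Eisenstein's criterion with the roles of leading and constant coefficient exchanged. If
  both factors had positive degree, x would divide both leading coefficients, so x^2 would divide u
  x.\<close>

lemma irreducible_reverse_Eisenstein: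
  fixes F :: "'a::idom poly"
  assumes x: "prime_elem x" and u: "u dvd 1" and lc: "lead_coeff F = u * x"
    and div: "\<And>i. i > 0 \<Longrightarrow> x dvd coeff F i" and nd: "\<not> x dvd coeff F 0"
  shows "irreducible F"
proof -
  have x0: "x \<noteq> 0" and xu: "\<not> x dvd 1" using x by (auto simp: prime_elem_def)
  have key: "x dvd lead_coeff A \<and> degree A > 0 \<or> degree A = 0"
    if F: "F = A * B" for A B
  proof (rule ccontr)
    assume "\<not> ?thesis"
    then have A: "\<not> x dvd lead_coeff A" "degree A > 0" by auto
    have B: "\<not> x dvd coeff B 0"
      using nd F by (auto simp: coeff_mult_0)
    \<comment> \<open>The last coefficient of B not divisible by x. In the coefficient of F at
      \<open>degree A + j\<close> every product other than \<open>lead_coeff A * coeff B j\<close>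
      is then divisible by x.\<close>
    define j where "j = (GREATEST j. \<not> x dvd coeff B j)"
    have bound: "\<And>j. \<not> x dvd coeff B j \<Longrightarrow> j \<le> degree B"
      by (metis dvd_0_right le_degree)
    have j: "\<not> x dvd coeff B j"
      unfolding j_def using B bound by (rule GreatestI_nat)
    have jm: "x dvd coeff B k" if "k > j" for k
      using Greatest_le_nat[of "\<lambda>j. \<not> x dvd coeff B j" k "degree B"] bound that
      unfolding j_def by force
    let ?n = "degree A + j"
    have "coeff F ?n = (\<Sum>i\<le>?n. coeff A i * coeff B (?n - i))"
      by (simp add: F coeff_mult)
    also have "\<dots> = coeff A (degree A) * coeff B (?n - degree A)
        + (\<Sum>i\<in>{..?n} - {degree A}. coeff A i * coeff B (?n - i))"
      by (rule sum.remove) auto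
    finally have e: "coeff F ?n = lead_coeff A * coeff B j
        + (\<Sum>i\<in>{..?n} - {degree A}. coeff A i * coeff B (?n - i))"
      by simp
    have "x dvd (\<Sum>i\<in>{..?n} - {degree A}. coeff A i * coeff B (?n - i))"
    proof (rule dvd_sum)
      fix i assume i: "i \<in> {..?n} - {degree A}"
      show "x dvd coeff A i * coeff B (?n - i)"
      proof (cases "i < degree A")
        case True
        then show ?thesis by (intro dvd_mult jm) simp
      next
        case False
        with i have "i > degree A" by auto
        then show ?thesis by (simp add: coeff_eq_0)
      qed
    qed
    moreover have "x dvd coeff F ?n" using A by (intro div) simp
    ultimately have "x dvd lead_coeff A * coeff B j"
      using e by (simp add: dvd_add_left_iff)
    with x A j show False by (simp add: prime_elem_dvd_mult_iff)
  qed
  \<comment> \<open>A constant factor divides u x but is not divisible by x, because the constant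
    term of F is not; hence it is a unit.\<close>
  have const: "A dvd 1" if F: "F = A * B" and "degree A = 0" for A B
  proof -
    obtain a where a: "A = [:a:]" using \<open>degree A = 0\<close> by (rule degree_eq_zeroE)
    have "u * x = a * lead_coeff B"
      unfolding lc[symmetric] F lead_coeff_mult by (simp add: a)
    moreover from u obtain v where "1 = u * v" by (rule dvdE)
    ultimately have "x = v * (a * lead_coeff B)"
      by (metis mult.assoc mult.commute mult_1)
    then have e: "x = a * (v * lead_coeff B)" by (simp add: mult_ac)
    have "\<not> x dvd a" using nd by (auto simp: F a)
    with x e have "x dvd v * lead_coeff B"
      by (metis dvd_refl prime_elem_dvd_mult_iff)
    then obtain r where "v * lead_coeff B = x * r" by blast
    with e have "x * (a * r) = x * 1" by (simp add: mult_ac)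
    with x0 have "a * r = 1" by (simp only: mult_cancel_left) simp
    then show ?thesis by (metis a dvd_triv_left is_unit_const_poly_iff)
  qed
  show ?thesis
  proof (rule irreducibleI)
    show "F \<noteq> 0" using nd by auto
    show "\<not> F dvd 1"
    proof
      assume "F dvd 1"
      then have "degree F = 0" by (auto elim: is_unit_polyE)
      with lc nd show False by simp
    qed
    fix A B assume F: "F = A * B"
    then have F': "F = B * A" by (simp add: mult.commute)
    show "A dvd 1 \<or> B dvd 1"
    proof (cases "degree A = 0 \<or> degree B = 0")
      case True
      then show ?thesis using const[OF F] const[OF F'] by blast
    next
      case False
      with key[OF F] key[OF F'] have "x * x dvd lead_coeff A * lead_coeff B"
        by (simp add: mult_dvd_mono)
      then have "x * x dvd x * u" by (simp add: lc[symmetric] F lead_coeff_mult mult.commute[of x u])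
      with x0 have "x dvd u" by simp
      with u xu show ?thesis using dvd_trans by blast
    qed
  qed
qed

lemma conic_eq: "conic = [:[:0, 0, 1:], [:[:0, - 2:]:]:]"
  by (simp add: conic_def varY_def varX_def varZ_def constP_def power2_eq_square)

lemma not_varX_dvd_conic: "\<not> varX dvd (conic :: 'a::field pol3)"
proof -
  have "\<not> [:0, 1:] dvd (1 :: 'a poly)" by (auto simp: is_unit_poly_iff)
  moreover have "coeff (coeff conic 0) 2 = (1 :: 'a poly)"
    by (simp add: conic_eq numeral_2_eq_2)
  ultimately show ?thesis
    by (metis const_poly_dvd_iff varX_def)
qed

text \<open>As a polynomial in Z the conic is linear with constant term Y^2 and leading coefficient
  -2X, so reversed Eisenstein applies at the prime X with the unit -2.\<close>

lemma irreducible_conic: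
  assumes "(2 :: 'a::field) \<noteq> 0"
  shows "irreducible (conic :: 'a pol3)"
proof (rule irreducible_reverse_Eisenstein)
  show "prime_elem [:[:0, 1 :: 'a:]:]" by (intro lift_prime_elem_poly prime_elem_X)
  show "[:[:- 2 :: 'a:]:] dvd 1" using assms by (simp add: is_unit_const_poly_iff dvd_field_iff)
  show "lead_coeff conic = [:[:- 2:]:] * [:[:0, 1 :: 'a:]:]" using assms by (simp add: conic_eq)
  show "[:[:0, 1:]:] dvd coeff (conic :: 'a pol3) i" if "i > 0" for i
  proof -
    have "[:[:0, - 2 :: 'a:]:] = [:[:0, 1:]:] * [:[:- 2:]:]" by simp
    then have "[:0, 1:] dvd [:0, - 2 :: 'a:]"
      by (metis const_poly_dvd_const_poly_iff dvd_triv_left)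
    then show ?thesis using that by (auto simp: conic_eq coeff_pCons split: nat.splits)
  qed
  show "\<not> [:[:0, 1:]:] dvd coeff (conic :: 'a pol3) 0"
    using not_varX_dvd_conic[where 'a = 'a]
    by (auto simp: conic_eq const_poly_dvd_iff coeff_pCons is_unit_poly_iff split: nat.splits)
qed

text \<open>Modulo the conic, 2X (X,Y,Z) is the parametrized point with s = 2X and t = Y, where F
  vanishes by \<open>ev_conic_point\<close>. So the conic divides (2X)^d F, and the power of 2X can
  be cancelled because X is a prime not dividing the conic.\<close>

lemma conic_dvd_if_restr_0:
  fixes F :: "'a::field pol3"
  assumes two: "(2 :: 'a) \<noteq> 0" and F: "homog_of_deg F d" and 0: "restr F = 0"
  shows "conic dvd F"
proof -
  let ?s = "constP 2 * varX :: 'a pol3"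
  have half: "constP (1 / 2) * constP 2 = (1 :: 'a pol3)"
    using two by (simp add: constP_hom(4)[symmetric] constP_hom(2))
  have "conic dvd eval3 F (?s * varX) (?s * varY) (?s * varZ)
      - eval3 F (constP (1 / 2) * ?s ^ 2) (?s * varY) (varY ^ 2)"
    unfolding eval3_ev
  proof (rule ev_cong_mod[OF unital_hom_constP])
    have "constP (1 / 2) * ?s ^ 2 = (constP (1 / 2) * constP 2) * (?s * varX)"
      by (simp add: power2_eq_square mult_ac)
    then show "conic dvd ?s * varX - constP (1 / 2) * ?s ^ 2"
      unfolding half by simp
    have "?s * varZ - varY ^ 2 = - conic" by (simp add: conic_def)
    then show "conic dvd ?s * varZ - varY ^ 2" by simp
  qed simp
  also have "eval3 F (constP (1 / 2) * ?s ^ 2) (?s * varY) (varY ^ 2) = 0"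
    unfolding eval3_ev ev_conic_point[OF unital_hom_constP F] by (simp add: 0 constP_hom)
  also have "eval3 F (?s * varX) (?s * varY) (?s * varZ) = ?s ^ d * F"
    unfolding eval3_ev ev_homog[OF unital_hom_constP F] by (simp flip: eval3_ev add: ev_id)
  finally have "conic dvd constP ((1 / 2) ^ d) * (?s ^ d * F)" by simp
  also have "constP ((1 / 2) ^ d) * (?s ^ d * F) = (constP (1 / 2) * constP 2) ^ d * (varX ^ d * F)"
    unfolding constP_hom(7) by (simp add: power_mult_distrib mult_ac)
  finally show ?thesis
    unfolding half using dvd_prime_elem_power_cancel[OF prime_elem_varX not_varX_dvd_conic] by simp
qed

lemma is_unit_pol3:
  assumes "(u :: 'a::field pol3) dvd 1"
  obtains c where "c \<noteq> 0" "u = constP c"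
proof -
  from assms obtain c where "u = [:[:[:c:]:]:]" "c dvd 1" by (auto elim!: is_unit_polyE)
  then show ?thesis by (intro that[of c]) (auto simp: constP_def)
qed

section \<open>Translation-invariant univariate polynomials\<close>

text \<open>Over an algebraically closed field p splits into linear factors, here pairwise distinct,
  which are removed from p and g one at a time.\<close>

lemma dvd_if_simple_roots:
  fixes p g :: "'a::field poly"
  assumes alg_closed: "\<forall>f :: 'a poly. degree f \<ge> 1 \<longrightarrow> (\<exists>x. poly f x = 0)"
  shows "p \<noteq> 0 \<Longrightarrow> (\<And>x. poly p x = 0 \<Longrightarrow> poly g x = 0 \<and> poly (pderiv p) x \<noteq> 0) \<Longrightarrow> p dvd g"
proof (induction "degree p" arbitrary: p g)
  case 0
  then obtain a where "p = [:a:]" "a \<noteq> 0" by (auto elim: degree_eq_zeroE)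
  then show ?case by (simp add: const_poly_dvd_iff dvd_field_iff)
next
  case (Suc k)
  then obtain x where x: "poly p x = 0" using alg_closed by (metis le_add1 plus_1_eq_Suc)
  then obtain p' where p: "p = [:- x, 1:] * p'" using poly_eq_0_iff_dvd by blast
  from x Suc obtain g' where g: "g = [:- x, 1:] * g'" using poly_eq_0_iff_dvd by blast
  have p'0: "p' \<noteq> 0" using p Suc.prems by auto
  have "p' dvd g'"
  proof (rule Suc.hyps(1))
    show "k = degree p'" using Suc.hyps(2) p p'0 by (simp add: degree_mult_eq del: mult_pCons_left)
    fix y assume y: "poly p' y = 0"
    have "poly p y = 0" using y by (simp add: p del: mult_pCons_left)
    then have *: "poly g y = 0" "poly (pderiv p) y \<noteq> 0" using Suc.prems by auto
    \<comment> \<open>As this is nonzero, y differs from x, so the root y of g is inherited by g',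
      and y is a simple root of p'.\<close>
    have "poly (pderiv p) y = (y - x) * poly (pderiv p') y"
      by (simp add: p pderiv_mult pderiv_pCons y del: mult_pCons_left)
    with * show "poly g' y = 0 \<and> poly (pderiv p') y \<noteq> 0"
      by (auto simp: g simp del: mult_pCons_left)
  qed (fact p'0)
  then show ?case unfolding p g by (rule mult_dvd_mono[OF dvd_refl])
qed

text \<open>The polynomial w = u^q - u, whose roots are the elements of \<open>Fq q\<close>.\<close>

definition frob_poly :: "nat \<Rightarrow> 'a::field poly" where
  "frob_poly q = monom 1 q - [:0, 1:]"

lemma coeff_frob_poly: "coeff (frob_poly q) i = (if i = q then 1 else 0) - (if i = 1 then 1 else 0)"
  by (auto simp: frob_poly_def coeff_pCons split: nat.splits)

lemma degree_frob_poly: "q \<ge> 2 \<Longrightarrow> degree (frob_poly q) = q"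
  by (intro antisym degree_le le_degree) (auto simp: coeff_frob_poly)

lemma frob_poly_nonzero: "q \<ge> 2 \<Longrightarrow> frob_poly q \<noteq> 0"
  using degree_frob_poly[of q] by (metis degree_0 not_numeral_le_zero)

text \<open>Since q = 0 in the field, the derivative of u^q - u is -1, so all its roots are
  simple.\<close>

lemma frob_poly_dvd:
  fixes g :: "'a::field poly"
  assumes "\<forall>f :: 'a poly. degree f \<ge> 1 \<longrightarrow> (\<exists>x. poly f x = 0)"
    and "q \<ge> 2" and "of_nat q = (0 :: 'a)" and "\<And>a. a \<in> Fq q \<Longrightarrow> poly g a = 0"
  shows "frob_poly q dvd g"
proof (rule dvd_if_simple_roots)
  have "pderiv (frob_poly q) = (- 1 :: 'a poly)"
    using assms(3) by (simp add: frob_poly_def pderiv_diff pderiv_monom pderiv_pCons one_pCons)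
  then show "poly g x = 0 \<and> poly (pderiv (frob_poly q)) x \<noteq> 0" if "poly (frob_poly q) x = 0" for x
    using that assms(4) by (simp add: frob_poly_def poly_monom Fq_def)
qed (use assms in \<open>simp_all add: frob_poly_nonzero\<close>)

lemma frob_poly_shift:
  fixes a :: "'a::field"
  assumes "prime CHAR('a)" "q = CHAR('a) ^ n" "a \<in> Fq q"
  shows "pcompose (frob_poly q) [:a, 1:] = frob_poly q"
proof -
  have "[:a, 1:] ^ q = ([:a:] + [:0, 1:]) ^ q" by simp
  also have "\<dots> = [:a:] ^ q + [:0, 1:] ^ q"
    using assms by (intro freshmans_dream'[where n = n]) simp_all
  also have "\<dots> = [:a:] + monom 1 q"
    using assms(3) by (simp add: Fq_def poly_const_pow monom_altdef)
  finally have "[:a, 1:] ^ q = [:a:] + monom 1 q" .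
  moreover have "pcompose (monom 1 q) [:a, 1:] = [:a, 1:] ^ q"
    by (simp add: monom_altdef unital_homD(7)[OF unital_hom_pcompose] pcompose_pCons)
  ultimately show ?thesis
    by (simp add: frob_poly_def pcompose_diff pcompose_pCons)
qed

definition periodic :: "nat \<Rightarrow> 'a::field poly \<Rightarrow> bool" where
  "periodic q f \<longleftrightarrow> (\<forall>a \<in> Fq q. pcompose f [:a, 1:] = f)"

text \<open>One step of the expansion in powers of w: f - f(0) vanishes on \<open>Fq q\<close>, so w
  divides it, and the quotient is again periodic because w is.\<close>

lemma periodic_split:
  fixes f :: "'a::field poly"
  assumes ac: "\<forall>f :: 'a poly. degree f \<ge> 1 \<longrightarrow> (\<exists>x. poly f x = 0)"
    and q: "prime CHAR('a)" "q = CHAR('a) ^ n" "n \<ge> 1" and f: "periodic q f"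
  obtains g where "f = [:poly f 0:] + frob_poly q * g" "periodic q g"
    "g = 0 \<or> degree f = q + degree g"
proof -
  have p2: "CHAR('a) \<ge> 2" using q(1) by (rule prime_ge_2_nat)
  moreover have "CHAR('a) ^ 1 \<le> q" unfolding q(2) using q(3) p2 by (intro power_increasing) auto
  ultimately have q2: "q \<ge> 2" by simp
  have q0: "of_nat q = (0 :: 'a)" using q by (simp add: of_nat_power power_0_left)
  have "frob_poly q dvd f - [:poly f 0:]"
  proof (rule frob_poly_dvd[OF ac q2 q0])
    fix a :: 'a assume "a \<in> Fq q"
    with f have "poly (pcompose f [:a, 1:]) 0 = poly f 0" by (simp add: periodic_def)
    then show "poly (f - [:poly f 0:]) a = 0" by (simp add: poly_pcompose)
  qed
  then obtain g where "f - [:poly f 0:] = frob_poly q * g" by (rule dvdE)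
  then have g: "f = [:poly f 0:] + frob_poly q * g" by (simp add: algebra_simps)
  have "pcompose g [:a, 1:] = g" if a: "a \<in> Fq q" for a
  proof -
    have "f = pcompose ([:poly f 0:] + frob_poly q * g) [:a, 1:]"
      using f a g by (simp add: periodic_def)
    also have "\<dots> = [:poly f 0:] + frob_poly q * pcompose g [:a, 1:]"
      by (simp add: pcompose_add pcompose_mult frob_poly_shift[OF q(1,2) a])
    finally have "frob_poly q * g = frob_poly q * pcompose g [:a, 1:]"
      using g by (metis add_left_cancel)
    then show ?thesis using frob_poly_nonzero[OF q2] by auto
  qed
  moreover have "degree f = q + degree g" if "g \<noteq> 0"
  proof -
    have "degree (frob_poly q * g) = q + degree g"
      using that q2 by (simp add: degree_mult_eq frob_poly_nonzero degree_frob_poly)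
    moreover from this have "degree f = degree (frob_poly q * g)"
      by (subst g, intro degree_add_eq_right) (use q2 in simp)
    ultimately show ?thesis by simp
  qed
  ultimately show ?thesis using g by (intro that[of g]) (auto simp: periodic_def)
qed

text \<open>After two splittings the degree bound 2q leaves only a constant quotient.\<close>

lemma periodic_quadratic:
  fixes f :: "'a::field poly"
  assumes ac: "\<forall>f :: 'a poly. degree f \<ge> 1 \<longrightarrow> (\<exists>x. poly f x = 0)"
    and q: "prime CHAR('a)" "q = CHAR('a) ^ n" "n \<ge> 1" and f: "periodic q f"
    and deg: "degree f \<le> 2 * q"
  obtains \<alpha> \<beta> \<gamma> where "f = smult \<alpha> (frob_poly q ^ 2) + smult \<beta> (frob_poly q) + [:\<gamma>:]"
proof -
  note split = periodic_split[OF ac q]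
  obtain g where g: "f = [:poly f 0:] + frob_poly q * g" "periodic q g" "g = 0 \<or> degree f = q + degree g"
    using split[OF f] .
  obtain h where h: "g = [:poly g 0:] + frob_poly q * h" "h = 0 \<or> degree g = q + degree h"
    using split[OF g(2)] .
  have "degree h = 0" using g(3) h(2) deg by auto
  then obtain \<alpha> where "h = [:\<alpha>:]" by (rule degree_eq_zeroE)
  then have "f = smult \<alpha> (frob_poly q ^ 2) + smult (poly g 0) (frob_poly q) + [:poly f 0:]"
    by (subst g(1), subst h(1)) (simp add: power2_eq_square algebra_simps)
  then show ?thesis by (rule that)
qed

section \<open>Invariant curves of degree at most q\<close>

lemma invariantD:
  assumes "invariant q F" "(g1, g2, g3) \<in> PGL2 q"
  obtains c where "c \<noteq> 0" "eval3 F g1 g2 g3 = constP c * F"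
  using assms unfolding invariant_def by (metis (mono_tags, lifting) case_prod_conv)

lemma ev_invariant:
  assumes h: "unital_hom h" and "eval3 F g1 g2 g3 = constP c * F"
  shows "ev h F (ev h g1 A B C) (ev h g2 A B C) (ev h g3 A B C) = h c * ev h F A B C"
  unfolding ev_eval3[OF h, symmetric] assms(2) by (simp add: ev_hom[OF h] ev_gens[OF h])

lemma pcompose_restr:
  "pcompose (restr F) r = ev (\<lambda>a. [:a:]) F (pcompose [:0, 0, 1 / 2:] r) r 1"
  unfolding restr_def hom_ev[OF unital_hom_const unital_hom_pcompose]
  by (simp add: pcompose_pCons one_pCons)

text \<open>On the conic \<open>sigma a\<close> acts as u -> u + a, because u^2/2 + a u + a^2/2 = (u
  + a)^2/2.\<close>

lemma restr_sigma:
  assumes two: "(2 :: 'a::field) \<noteq> 0" and inv: "eval3 F g1 g2 g3 = constP c * F" and s: "(g1, g2, g3) = sigma (a :: 'a)"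
  shows "pcompose (restr F) [:a, 1:] = smult c (restr F)"
proof -
  have "pcompose [:0, 0, 1 / 2:] [:a, 1:] = [:0, 0, 1 / 2:] + [:a:] * [:0, 1:] + [:a\<^sup>2 / 2:]"
    using two by (simp add: pcompose_pCons power2_eq_square flip: add_divide_distrib mult_2)
  then show ?thesis
    using s ev_invariant[OF unital_hom_const inv, of "[:0, 0, 1 / 2:]" "[:0, 1:]" 1] unfolding pcompose_restr
    by (simp add: restr_def sigma_def ev_hom[OF unital_hom_const] ev_gens[OF unital_hom_const])
qed

lemma restr_delta:
  assumes inv: "eval3 F g1 g2 g3 = constP c * F" and s: "(g1, g2, g3) = delta b"
  shows "pcompose (restr F) [:0, b:] = smult c (restr F)"
  using s ev_invariant[OF unital_hom_const inv, of "[:0, 0, 1 / 2:]" "[:0, 1:]" 1] unfolding pcompose_restr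
  by (simp add: restr_def delta_def ev_hom[OF unital_hom_const] ev_gens[OF unital_hom_const]
      pcompose_pCons one_pCons add_ac power2_eq_square mult_ac)

text \<open>On the conic \<open>tau\<close> acts as u -> 2/u, which reverses the order of the
  coefficients and introduces powers of 2.\<close>

lemma coeff_restr_tau:
  fixes F :: "'a::field pol3"
  assumes two: "(2 :: 'a) \<noteq> 0" and inv: "eval3 F varZ varY varX = constP c * F" and F: "homog_of_deg F d"
    and j: "j \<le> 2 * d"
  shows "2 ^ d * c * coeff (restr F) j = 2 ^ (2 * d - j) * coeff (restr F) (2 * d - j)"
proof -
  note k = unital_hom_const[where 'a = 'a]
  \<comment> \<open>The left side is the conic point with homogeneous parameters s = 2, t = u; it is
    twice the image under \<open>tau\<close> of the point with parameter u, whence the factor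
    2^d.\<close>
  have "ev (\<lambda>a. [:a:]) F ([:1 / 2:] * [:2:] ^ 2) ([:2:] * [:0, 1:]) ([:0, 1:] ^ 2)
    = ev (\<lambda>a. [:a:]) F ([:2:] * 1) ([:2:] * [:0, 1:]) ([:2:] * [:0, 0, 1 / 2:])"
  proof -
    have 1: "[:1 / 2:] * [:2:] ^ 2 = [:2 :: 'a:] * 1"
      using two by (simp add: power2_eq_square del: numeral_times_numeral)
    have 2: "[:0, 1:] ^ 2 = [:2 :: 'a:] * [:0, 0, 1 / 2:]"
      using two by (simp add: power2_eq_square)
    show ?thesis unfolding 1 2 ..
  qed
  also have "\<dots> = [:2:] ^ d * ([:c:] * restr F)"
    unfolding ev_homog[OF k F] using ev_invariant[OF k inv, of "[:0, 0, 1 / 2:]" "[:0, 1:]" 1]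
    by (simp add: restr_def ev_gens[OF k])
  also have "coeff \<dots> j = 2 ^ d * c * coeff (restr F) j"
    by (simp add: poly_const_pow)
  finally have "2 ^ d * c * coeff (restr F) j =
      (\<Sum>m\<le>2 * d. coeff ([:coeff (restr F) m:] * [:2:] ^ m * [:0, 1:] ^ (2 * d - m)) j)"
    unfolding ev_conic_point[OF k F] by (simp add: coeff_sum)
  also have "\<dots> = (\<Sum>m\<le>2 * d. if m = 2 * d - j then 2 ^ m * coeff (restr F) m else 0)"
  proof (intro sum.cong refl)
    fix m assume m: "m \<in> {..2 * d}"
    have "[:coeff (restr F) m:] * [:2:] ^ m * [:0, 1:] ^ (2 * d - m)
        = monom (2 ^ m * coeff (restr F) m) (2 * d - m)"
      by (simp add: poly_const_pow monom_altdef mult.commute)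
    moreover have "2 * d - m = j \<longleftrightarrow> m = 2 * d - j" using m j by auto
    ultimately show "coeff ([:coeff (restr F) m:] * [:2:] ^ m * [:0, 1:] ^ (2 * d - m)) j =
        (if m = 2 * d - j then 2 ^ m * coeff (restr F) m else 0)"
      by simp
  qed
  also have "\<dots> = 2 ^ (2 * d - j) * coeff (restr F) (2 * d - j)"
    by simp
  finally show ?thesis .
qed

text \<open>A unipotent element fixing the point (0,0,1) of the conic fixes no line through
  it except the tangent, so the curve cannot meet the conic there with multiplicity one.\<close>

lemma restr_tangent:
  fixes F :: "'a::field pol3"
  assumes F: "homog_of_deg F d" and d: "d \<ge> 1"
    and tau: "eval3 F varZ varY varX = constP c * F" and c: "c \<noteq> 0"
    and sigma: "eval3 F g1 g2 g3 = constP e * F" "(g1, g2, g3) = sigma 1"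
    and 0: "coeff (restr F) 0 = 0"
  shows "coeff (restr F) 1 = 0"
proof -
  note k = unital_hom_const[where 'a = 'a]
  let ?E = "ev (\<lambda>a. [:a:]) F"
  have t: "?E C B A = [:c:] * ?E A B C" for A B C
    using ev_invariant[OF k tau, of A B C] by (simp add: ev_gens[OF k])
  have s: "?E (A + B + [:1 / 2:] * C) (B + C) C = [:e:] * ?E A B C" for A B C
    using ev_invariant[OF k sigma(1), of A B C] sigma(2)
    by (simp add: sigma_def ev_gens[OF k] ev_hom[OF k])
  \<comment> \<open>Conjugating \<open>sigma 1\<close>, which fixes (1,0,0), by \<open>tau\<close>
    gives a unipotent map fixing (0,0,1).\<close>
  have u: "?E A (B + A) (C + B + [:1 / 2:] * A) = [:e:] * ?E A B C" for A B C
  proof -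
    have "[:c:] * ?E A (B + A) (C + B + [:1 / 2:] * A) = [:e:] * ?E C B A"
      by (subst t[symmetric]) (rule s)
    also have "\<dots> = [:c:] * ([:e:] * ?E A B C)"
      by (subst t) (rule mult.left_commute)
    finally show ?thesis using c by (metis mult_cancel_left pCons_eq_0_iff)
  qed
  obtain Dx Dy Dz where D: "\<And>A B C. coeff A 0 = 0 \<Longrightarrow> coeff B 0 = 0 \<Longrightarrow> coeff C 0 = 1 \<Longrightarrow>
      coeff (?E A B C) 1 = coeff A 1 * Dx + coeff B 1 * Dy + coeff C 1 * Dz"
    using ev_linear_part[of 0 0 1 F] by blast
  have E0: "?E 0 0 C = 0" for C
  proof -
    have "?E (C * 0) (C * 0) (C * 1) = C ^ d * ?E 0 0 1"
      by (rule ev_homog[OF k F])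
    moreover have "pcompose (restr F) 0 = 0" using 0 by (simp add: pcompose_0')
    then have "?E 0 0 1 = 0" unfolding pcompose_restr by (simp add: pcompose_pCons)
    ultimately show ?thesis by simp
  qed
  \<comment> \<open>F vanishes along (0,0,1+u). The next two equations compare first-order terms of
    the invariance relation in the directions Y and X.\<close>
  have "Dz = 0"
    using D[of 0 0 "[:1, 1:]"] by (simp add: E0)
  moreover have "Dy + Dz = e * Dy"
    using u[of 0 "[:0, 1:]" 1] D[of 0 "[:0, 1:]" "[:1, 1:]"] D[of 0 "[:0, 1:]" 1] by (simp add: one_pCons)
  moreover have "Dx + Dy + 1 / 2 * Dz = e * Dx"
    using u[of "[:0, 1:]" 0 1] D[of "[:0, 1:]" "[:0, 1:]" "[:1, 1 / 2:]"] D[of "[:0, 1:]" 0 1]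
    by (simp add: one_pCons)
  \<comment> \<open>If e = 1, the X-equation gives this; otherwise the Y-equation does.
    \<open>Dy\<close> is the coefficient of u in \<open>restr F\<close>.\<close>
  ultimately have "Dy = 0" by (cases "e = 1") auto
  then show ?thesis using D[of "[:0, 0, 1 / 2:]" "[:0, 1:]" 1] by (simp add: restr_def one_pCons)
qed

lemma irreducible_pol3_dvd:
  assumes "irreducible (F :: 'a::field pol3)" "m dvd F" "\<not> m dvd 1"
  obtains c where "c \<noteq> 0" "F = constP c * m"
proof -
  from assms(2) obtain Q where "F = m * Q" by (rule dvdE)
  moreover from this have "Q dvd 1" using assms by (metis irreducibleD)
  ultimately show ?thesis using that by (metis is_unit_pol3 mult.commute)
qed

lemma frob_poly_power2:
  "frob_poly q ^ 2 = monom 1 (2 * q) - monom 2 (q + 1) + (monom 1 2 :: 'a::field poly)"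
proof -
  have x: "[:0, 1:] = (monom 1 1 :: 'a poly)" by (simp add: monom_altdef)
  have "frob_poly q ^ 2 = monom 1 q * monom 1 q - [:2:] * (monom 1 q * monom 1 1)
      + (monom 1 1 * monom 1 1 :: 'a poly)"
    unfolding frob_poly_def x numeral_poly[symmetric] by (simp add: power2_eq_square algebra_simps)
  then show ?thesis by (simp add: mult_monom smult_monom mult_2 numeral_2_eq_2)
qed

lemma constP_2: "constP 2 = 2"
  by (simp add: constP_def numeral_poly)

lemma not_unit_varZ_minus_varX: "\<not> (varZ - varX :: 'a::field pol3) dvd 1"
  by (auto simp: varZ_def varX_def is_unit_poly_iff)

text \<open>On the line Z = X, which \<open>tau\<close> fixes pointwise, the sign forces F = -F and
  hence F = 0; an irreducible F would then be that line.\<close>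

lemma not_tau_antisymmetric:
  fixes F :: "'a::field pol3"
  assumes two: "(2 :: 'a) \<noteq> 0" and F: "homog_of_deg F d" "irreducible F" "d \<noteq> 1"
  shows "eval3 F varZ varY varX \<noteq> constP (- 1) * F"
proof
  note k = unital_hom_constP[where 'a = 'a]
  assume "eval3 F varZ varY varX = constP (- 1) * F"
  from ev_invariant[OF k this, of varX varY varX]
  have "ev constP F varX varY varX = - ev constP F varX varY varX"
    by (simp add: ev_gens[OF k] constP_hom)
  then have "constP 2 * ev constP F varX varY varX = 0"
    unfolding constP_2 by (simp add: eq_neg_iff_add_eq_0)
  then have "ev constP F varX varY varX = 0"
    using two by (simp add: constP_def)
  moreover have "varZ - varX dvd ev constP F varX varY varZ - ev constP F varX varY varX"
    by (rule ev_cong_mod[OF k]) simp_all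
  ultimately have "varZ - varX dvd F"
    using ev_id[of F] by (simp add: eval3_ev)
  then obtain e where "e \<noteq> 0" "F = constP e * (varZ - varX)"
    using irreducible_pol3_dvd[OF F(2) _ not_unit_varZ_minus_varX] by blast
  then have "coeff3 F 0 0 1 \<noteq> 0"
    by (simp add: coeff3_def constP_def varZ_def varX_def)
  then have "0 + 0 + 1 = d" using F(1) unfolding homog_of_deg_def by blast
  with F(3) show False by simp
qed

lemma conic_dvd_invariant:
  fixes F :: "'a::field pol3"
  assumes ac: "\<forall>f :: 'a poly. degree f \<ge> 1 \<longrightarrow> (\<exists>x. poly f x = 0)"
    and q: "prime CHAR('a)" "q = CHAR('a) ^ n" "n \<ge> 1" and odd: "odd CHAR('a)"
    and F: "homog_of_deg F d" "irreducible F" "invariant q F" and d: "1 \<le> d" "d \<le> q"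
  shows "conic dvd F"
proof (rule ccontr)
  assume ncon: "\<not> conic dvd F"
  have p3: "CHAR('a) \<ge> 3" using prime_ge_2_nat[OF q(1)] odd by (cases "CHAR('a) = 2") auto
  moreover have "CHAR('a) ^ 1 \<le> q" unfolding q(2) using q(3) p3 by (intro power_increasing) auto
  ultimately have q3: "q \<ge> 3" by simp
  have qodd: "odd q" using odd q(2) by simp
  have q0: "of_nat q = (0 :: 'a)" using q by (simp add: of_nat_power power_0_left)
  have two: "(2 :: 'a) \<noteq> 0"
  proof
    assume "(2 :: 'a) = 0"
    then have "CHAR('a) dvd 2" using of_nat_eq_0_iff_char_dvd[of 2, where 'a = 'a] by simp
    then show False using p3 by (auto dest: dvd_imp_le)
  qed
  define f where "f = restr F"
  have f0: "f \<noteq> 0" using conic_dvd_if_restr_0[OF two F(1)] ncon unfolding f_def by blast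
  have deg: "degree f \<le> 2 * d" unfolding f_def by (rule degree_restr[OF F(1)])
  have "periodic q f"
    unfolding periodic_def
  proof
    fix a :: 'a assume "a \<in> Fq q"
    then have a: "sigma a \<in> PGL2 q" by (rule PGL2.gen_sigma)
    obtain g1 g2 g3 where g: "(g1, g2, g3) = sigma a" by (metis prod_cases3)
    with a F(3) obtain c where "eval3 F g1 g2 g3 = constP c * F" by (metis invariantD)
    then have c: "pcompose f [:a, 1:] = smult c f"
      unfolding f_def by (rule restr_sigma[OF two _ g])
    \<comment> \<open>A translation preserves the leading coefficient, so the scalar c is 1.\<close>
    have "lead_coeff (pcompose f [:a, 1:]) = lead_coeff f"
      by (subst lead_coeff_comp) simp_all
    then have "c * lead_coeff f = lead_coeff f" unfolding c lead_coeff_smult .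
    then have "c = 1" using f0 by (metis leading_coeff_0_iff mult_cancel_right2)
    with c show "pcompose f [:a, 1:] = f" by simp
  qed
  then obtain \<alpha> \<beta> \<gamma> where f: "f = smult \<alpha> (frob_poly q ^ 2) + smult \<beta> (frob_poly q) + [:\<gamma>:]"
    using periodic_quadratic[OF ac q] deg d by (metis mult_le_mono2 order.trans)
  have cf: "coeff f m = \<alpha> * ((if m = 2 * q then 1 else 0) - (if m = q + 1 then 2 else 0) + (if m = 2 then 1 else 0))
      + \<beta> * ((if m = q then 1 else 0) - (if m = 1 then 1 else 0)) + (if m = 0 then \<gamma> else 0)" for m
    using q3 unfolding f by (simp add: frob_poly_power2 coeff_frob_poly coeff_pCons split: nat.splits)
  have "tau \<in> PGL2 q" by (rule PGL2.gen_tau)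
  then obtain c where c: "c \<noteq> 0" "eval3 F varZ varY varX = constP c * F"
    using F(3) by (auto simp: tau_def elim: invariantD)
  have tau: "2 ^ d * c * coeff f j = 2 ^ (2 * d - j) * coeff f (2 * d - j)" if "j \<le> 2 * d" for j
    unfolding f_def by (rule coeff_restr_tau[OF two c(2) F(1) that])
  have zero_iff: "coeff f (2 * d) = 0 \<longleftrightarrow> \<gamma> = 0"
    using tau[of 0] two c(1) q3 by (auto simp: cf[of 0])
  have "\<gamma> \<noteq> 0"
  proof
    assume "\<gamma> = 0"
    then have g0: "coeff f 0 = 0" and top: "coeff f (2 * d) = 0" using q3 zero_iff by (auto simp: cf[of 0])
    have "sigma (1 :: 'a) \<in> PGL2 q" by (rule PGL2.gen_sigma) (simp add: Fq_def)
    moreover obtain g1 g2 g3 where g: "(g1, g2, g3) = sigma (1 :: 'a)" by (metis prod_cases3)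
    ultimately obtain e where "eval3 F g1 g2 g3 = constP e * F" using F(3) by (metis invariantD)
    then have "coeff f 1 = 0"
      using restr_tangent[OF F(1) d(1) c(2,1) _ g] g0 unfolding f_def by blast
    then have "\<beta> = 0" using q3 by (simp add: cf)
    with \<open>\<gamma> = 0\<close> have f': "f = smult \<alpha> (frob_poly q ^ 2)" by (simp add: f)
    with f0 have "\<alpha> \<noteq> 0" by auto
    then have "coeff f (2 * q) \<noteq> 0" using q3 \<open>\<beta> = 0\<close> by (simp add: cf)
    then have "2 * q \<le> 2 * d" using deg le_degree order.trans by blast
    with d have "d = q" by simp
    with top \<open>coeff f (2 * q) \<noteq> 0\<close> show False by simp
  qed
  with zero_iff have top: "coeff f (2 * d) \<noteq> 0" by simp
  have dq: "d = q" and \<alpha>: "\<alpha> \<noteq> 0"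
  proof -
    have "d = q \<and> \<alpha> \<noteq> 0"
    proof (cases "\<alpha> = 0")
      case False
      then have "coeff f (2 * q) \<noteq> 0" using q3 by (simp add: cf)
      then have "2 * q \<le> 2 * d" using deg le_degree order.trans by blast
      with d False show ?thesis by simp
    next
      case True
      \<comment> \<open>With \<alpha> = 0 only the exponents 0, 1 and q occur in f, and 2d is none
        of them.\<close>
      have "2 * d \<noteq> q" using qodd by auto
      with top d True show ?thesis by (simp add: cf split: if_splits)
    qed
    then show "d = q" "\<alpha> \<noteq> 0" by auto
  qed
  have scale: "b ^ m * coeff f m = coeff f m" if b: "b \<in> Fq q" "b \<noteq> 0" for b :: 'a and m
  proof -
    have "delta b \<in> PGL2 q" using b by (rule PGL2.gen_delta)
    moreover obtain g1 g2 g3 where g: "(g1, g2, g3) = delta b" by (metis prod_cases3)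
    ultimately obtain e where "eval3 F g1 g2 g3 = constP e * F" using F(3) by (metis invariantD)
    then have e: "pcompose f [:0, b:] = smult e f" unfolding f_def by (rule restr_delta[OF _ g])
    have *: "b ^ i * coeff f i = e * coeff f i" for i
      using arg_cong[OF e, of "\<lambda>p. coeff p i"] by (simp add: coeff_pcompose_linear)
    \<comment> \<open>Scaling fixes the constant term \<gamma>, which is nonzero.\<close>
    from *[of 0] have "e = 1" using \<open>\<gamma> \<noteq> 0\<close> q3 by (simp add: cf[of 0])
    with *[of m] show ?thesis by simp
  qed
  \<comment> \<open>The coefficient of u^2 is \<alpha>, as q is at least 3. Hence all roots of u^q -
    u are roots of u^3 - u, which bounds q.\<close>
  have "b ^ 3 = b" if "b \<in> Fq q" for b :: 'a
  proof (cases "b = 0")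
    case False
    have "b ^ 2 * \<alpha> = \<alpha>" using scale[OF that False, of 2] q3 by (auto simp: cf)
    with \<alpha> have "b ^ 2 = 1" by simp
    then show ?thesis by (simp add: numeral_3_eq_3 power2_eq_square)
  qed simp
  then have "frob_poly q dvd (frob_poly 3 :: 'a poly)"
    using q3 by (intro frob_poly_dvd[OF ac _ q0]) (auto simp: frob_poly_def poly_monom)
  then have "q \<le> 3"
    using dvd_imp_degree_le[of "frob_poly q" "frob_poly 3 :: 'a poly"] q3
    by (simp add: frob_poly_nonzero degree_frob_poly)
  with q3 have q_3: "q = 3" by simp
  with q0 have three: "(3 :: 'a) = 0" by simp
  have "(- 1 :: 'a) \<in> Fq q" using qodd by (simp add: Fq_def)
  \<comment> \<open>The coefficient of u is -\<beta>, and scaling by -1 changes its sign.\<close>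
  from scale[OF this, of 1] have "2 * \<beta> = 0" using q3 by (simp add: cf)
  with two have "\<beta> = 0" by simp
  \<comment> \<open>For d = q = 3, \<open>tau\<close> pairs the coefficient -2 \<alpha> of u^4 with
    the coefficient \<alpha> of u^2; in characteristic 3 this gives c = -1.\<close>
  have "2 ^ 3 * c * (- 2 * \<alpha>) = 2 ^ 2 * \<alpha>"
    using tau[of 4] by (simp add: dq q_3 cf \<open>\<beta> = 0\<close>)
  then have "(16 * c + 4) * \<alpha> = 0" by (simp add: algebra_simps) (metis add.left_inverse)
  with \<alpha> have "16 * c + 4 = 0" by simp
  then have "c + 1 = - (3 * (5 * c + 1))" by (simp add: algebra_simps)
  with three have "c = - 1" by (simp add: eq_neg_iff_add_eq_0)
  with c(2) not_tau_antisymmetric[OF two F(1,2)] dq q_3 show False by simp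
qed

section \<open>Invariance of the conic and of a curve of degree q + 1\<close>

lemma eval3_comp3:
  assumes "comp3 (g1, g2, g3) (h1, h2, h3) = (k1, k2, k3)"
  shows "eval3 F k1 k2 k3 = eval3 (eval3 F g1 g2 g3) h1 h2 h3"
  using assms ev_eval3[OF unital_hom_constP, of F g1 g2 g3 h1 h2 h3] by (simp add: comp3_def eval3_ev)

text \<open>It suffices to test the generators, because the scalars multiply under
  composition.\<close>

lemma invariantI:
  fixes F :: "'a::field pol3"
  assumes tau: "\<exists>c. c \<noteq> 0 \<and> eval3 F varZ varY varX = constP c * F"
    and sigma: "\<And>a. a \<in> Fq q \<Longrightarrow> \<exists>c. c \<noteq> 0 \<and> eval3 F (varX + constP a * varY + constP (a^2 / 2) * varZ)
      (varY + constP a * varZ) varZ = constP c * F"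
    and delta: "\<And>b. b \<in> Fq q \<Longrightarrow> b \<noteq> 0 \<Longrightarrow>
      \<exists>c. c \<noteq> 0 \<and> eval3 F (constP (b^2) * varX) (constP b * varY) varZ = constP c * F"
  shows "invariant q F"
  unfolding invariant_def
proof
  fix g :: "'a lin3" assume "g \<in> PGL2 q"
  then show "\<exists>c. c \<noteq> 0 \<and> (case g of (g1, g2, g3) \<Rightarrow> eval3 F g1 g2 g3 = constP c * F)"
  proof induction
    case ident
    show ?case by (intro exI[of _ 1]) (simp add: ev_id constP_hom)
  next
    case gen_tau
    then show ?case using tau by (simp add: tau_def)
  next
    case (gen_sigma a)
    then show ?case using sigma by (simp add: sigma_def)
  next
    case (gen_delta b)
    then show ?case using delta by (simp add: delta_def)
  next
    case (comp g h)
    obtain g1 g2 g3 where g: "g = (g1, g2, g3)" by (metis prod_cases3)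
    obtain h1 h2 h3 where h: "h = (h1, h2, h3)" by (metis prod_cases3)
    obtain k1 k2 k3 where k: "comp3 g h = (k1, k2, k3)" by (metis prod_cases3)
    from comp g h obtain c e where "c \<noteq> 0" "eval3 F g1 g2 g3 = constP c * F"
      "e \<noteq> 0" "eval3 F h1 h2 h3 = constP e * F" by auto
    then have "eval3 F k1 k2 k3 = constP (c * e) * F"
      using eval3_comp3[of g1 g2 g3 h1 h2 h3 k1 k2 k3 F] k g h
      by (simp add: eval3_ev ev_hom[OF unital_hom_constP] ev_gens[OF unital_hom_constP] constP_hom mult_ac)
    with \<open>c \<noteq> 0\<close> \<open>e \<noteq> 0\<close> k show ?case by (intro exI[of _ "c * e"]) simp
  qed
qed

lemma constP_half_twice:
  assumes "(2 :: 'a::field) \<noteq> 0"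
  shows "constP (x / 2) + constP (x / 2) = (constP x :: 'a pol3)"
proof -
  have "x / 2 + x / 2 = x"
    using assms by (metis add_divide_distrib mult_2 nonzero_mult_div_cancel_left)
  then show ?thesis using constP_hom(3)[of "x / 2" "x / 2"] by simp
qed

lemma invariant_conic:
  assumes two: "(2 :: 'a::field) \<noteq> 0"
  shows "invariant q (conic :: 'a pol3)"
proof (rule invariantI)
  note k = unital_hom_constP[where 'a = 'a]
  note [simp] = eval3_ev ev_hom[OF k] ev_gens[OF k] conic_def
  show "\<exists>c. c \<noteq> 0 \<and> eval3 conic varZ varY varX = constP c * (conic :: 'a pol3)"
    by (intro exI[of _ 1]) (simp add: constP_hom mult_ac)
  fix a :: 'a
  show "\<exists>c. c \<noteq> 0 \<and> eval3 conic (varX + constP a * varY + constP (a^2 / 2) * varZ)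
      (varY + constP a * varZ) varZ = constP c * conic"
  proof (intro exI[of _ 1] conjI)
    have h: "constP a ^ 2 = constP (a^2 / 2) + constP (a^2 / 2)"
      by (simp only: constP_half_twice[OF two] constP_hom)
    \<comment> \<open>\<open>constP (a^2 / 2)\<close> is opaque to ring normalization, so the
      relation a^2 = a^2/2 + a^2/2 is isolated as a coefficient that vanishes by
      \<open>h\<close>.\<close>
    have "(varY + constP a * varZ) ^ 2 - constP 2 * (varX + constP a * varY + constP (a^2 / 2) * varZ) * varZ
      = varY ^ 2 - constP 2 * varX * varZ + (constP a ^ 2 - (constP (a^2 / 2) + constP (a^2 / 2))) * varZ ^ 2"
      unfolding constP_2 by (simp add: power2_eq_square algebra_simps)
    then show "eval3 conic (varX + constP a * varY + constP (a^2 / 2) * varZ)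
      (varY + constP a * varZ) varZ = constP 1 * conic"
      by (simp add: h constP_hom)
  qed simp
  fix b :: 'a assume "b \<noteq> 0"
  then show "\<exists>c. c \<noteq> 0 \<and> eval3 conic (constP (b^2) * varX) (constP b * varY) varZ = constP c * conic"
    by (intro exI[of _ "b ^ 2"]) (simp add: constP_hom power2_eq_square algebra_simps)
qed

section \<open>The curve pairing a point with its Frobenius image\<close>

definition frob_curve :: "nat \<Rightarrow> 'a::comm_ring_1 pol3" where
  "frob_curve q = varY ^ (q + 1) - varX ^ q * varZ - varX * varZ ^ q"

lemma frob_curve_monom:
  "frob_curve q = monom (monom (monom 1 0) (q + 1)) 0
    - monom (monom (monom 1 q) 0) 1 - monom (monom (monom 1 1) 0) q"
proof -
  have m: "[:0, 1:] ^ i = monom 1 i" for i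
    by (simp add: monom_altdef)
  have X: "varX ^ i = monom (monom (monom 1 i) 0) 0" for i
    by (simp add: varX_def poly_const_pow monom_0 m)
  have Y: "varY ^ i = monom (monom (monom 1 0) i) 0" for i
    by (simp add: varY_def poly_const_pow monom_0 m)
  have Z: "varZ ^ i = monom 1 i" for i
    by (simp add: varZ_def m)
  have "frob_curve q = varY ^ (q + 1) - varX ^ q * varZ ^ 1 - varX ^ 1 * varZ ^ q"
    by (simp add: frob_curve_def)
  then show ?thesis
    unfolding X Y Z by (simp add: mult_monom)
qed

lemma homog_frob_curve: "homog_of_deg (frob_curve q :: 'a::field pol3) (q + 1)"
proof -
  have c: "coeff3 (frob_curve q :: 'a pol3) i j k = (if i = 0 \<and> j = q + 1 \<and> k = 0 then 1 else 0)
     - (if i = q \<and> j = 0 \<and> k = 1 then 1 else 0) - (if i = 1 \<and> j = 0 \<and> k = q then 1 else 0)" for i j k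
  proof -
    have m: "coeff3 (monom (monom (monom 1 i') j') k') i j k = (if i = i' \<and> j = j' \<and> k = k' then 1 else (0 :: 'a))"
      for i' j' k'
      by (simp add: coeff3_def)
    have diff: "coeff3 (G - H) i j k = coeff3 G i j k - coeff3 H i j k" for G H :: "'a pol3"
      by (simp add: coeff3_def)
    show ?thesis unfolding frob_curve_monom diff m ..
  qed
  have "coeff3 (frob_curve q :: 'a pol3) 0 (q + 1) 0 = 1" using c[of 0 "q + 1" 0] by simp
  then have "(frob_curve q :: 'a pol3) \<noteq> 0" by (auto simp: coeff3_def)
  moreover have "i + j + k = q + 1" if "coeff3 (frob_curve q :: 'a pol3) i j k \<noteq> 0" for i j k
    using that c[of i j k] by (auto split: if_splits)
  ultimately show ?thesis unfolding homog_of_deg_def by blast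
qed

text \<open>For q at least 2 the leading coefficient in Z is -X, the coefficient of Z is -X^q, and
  the constant term Y^(q+1) is prime to X.\<close>

lemma irreducible_frob_curve:
  assumes "q \<ge> 2"
  shows "irreducible (frob_curve q :: 'a::field pol3)"
proof (rule irreducible_reverse_Eisenstein)
  let ?x = "[:[:0, 1 :: 'a:]:]"
  have x: "?x = monom (monom 1 1) 0" by (simp add: monom_altdef)
  show "prime_elem ?x" by (intro lift_prime_elem_poly prime_elem_X)
  show "- 1 dvd (1 :: 'a poly poly)" by simp
  have deg: "degree (frob_curve q :: 'a pol3) = q"
    using assms by (intro antisym degree_le le_degree) (auto simp: frob_curve_monom)
  show "lead_coeff (frob_curve q) = - 1 * ?x"
    unfolding deg using assms by (simp add: frob_curve_monom x)
  show "?x dvd coeff (frob_curve q) i" if "i > 0" for i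
  proof -
    have "?x dvd ?x ^ q" using assms by (intro dvd_power) auto
    also have "?x ^ q = monom (monom 1 q) 0" by (simp add: monom_altdef poly_const_pow)
    finally show ?thesis using that unfolding frob_curve_monom x by auto
  qed
  have "coeff (frob_curve q) 0 = monom (1 :: 'a poly) (q + 1)"
    using assms by (simp add: frob_curve_monom)
  moreover have "\<not> [:0, 1:] dvd (1 :: 'a poly)" by (auto simp: is_unit_poly_iff)
  ultimately show "\<not> ?x dvd coeff (frob_curve q) 0"
    by (metis coeff_monom const_poly_dvd_iff)
qed

text \<open>The q-th power map is additive and fixes the constants from \<open>Fq q\<close>, so it
  commutes with the generators; what remains is the invariance of the polar form.\<close>

lemma invariant_frob_curve:
  assumes q: "prime CHAR('a::field)" "q = CHAR('a) ^ n" and two: "(2 :: 'a) \<noteq> 0"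
  shows "invariant q (frob_curve q :: 'a pol3)"
proof (rule invariantI)
  note k = unital_hom_constP[where 'a = 'a]
  note [simp] = eval3_ev ev_hom[OF k] ev_gens[OF k]
  have add: "(G + H) ^ q = G ^ q + H ^ q" for G H :: "'a pol3"
    using q by (intro freshmans_dream'[where n = n]) simp_all
  \<comment> \<open>Needed so that a^2/2 is fixed by the q-th power map as well.\<close>
  have two_q: "(2 :: 'a) ^ q = 2"
    using freshmans_dream'[OF q, of 1 1] by simp
  show "\<exists>c. c \<noteq> 0 \<and> eval3 (frob_curve q) varZ varY varX = constP c * (frob_curve q :: 'a pol3)"
    by (intro exI[of _ 1]) (simp add: frob_curve_def constP_hom mult_ac)
  fix a :: 'a assume a: "a \<in> Fq q"
  then have aq: "a ^ q = a" by (simp add: Fq_def)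
  then have haq: "(a ^ 2 / 2) ^ q = a ^ 2 / 2"
    by (simp add: power_divide two_q power2_eq_square power_mult_distrib)
  show "\<exists>c. c \<noteq> 0 \<and> eval3 (frob_curve q) (varX + constP a * varY + constP (a^2 / 2) * varZ)
      (varY + constP a * varZ) varZ = constP c * frob_curve q"
  proof (intro exI[of _ 1] conjI)
    have h: "constP a * constP a = constP (a^2 / 2) + constP (a^2 / 2)"
      by (simp only: constP_half_twice[OF two] constP_hom power2_eq_square)
    have Xq: "(varX + constP a * varY + constP (a^2 / 2) * varZ) ^ q
        = varX ^ q + constP a * varY ^ q + constP (a^2 / 2) * varZ ^ q"
      by (simp only: add power_mult_distrib constP_hom(7)[symmetric] aq haq)
    have Yq: "(varY + constP a * varZ) ^ q = varY ^ q + constP a * varZ ^ q"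
      by (simp only: add power_mult_distrib constP_hom(7)[symmetric] aq)
    have e: "eval3 (frob_curve q) A B varZ = B ^ q * B - A ^ q * varZ - A * varZ ^ q" for A B :: "'a pol3"
      by (simp add: frob_curve_def mult.commute)
    have "frob_curve q = varY ^ q * varY - varX ^ q * varZ - varX * varZ ^ q
        + (constP a * constP a - (constP (a^2 / 2) + constP (a^2 / 2))) * (varZ ^ q * varZ)"
      unfolding h by (simp add: frob_curve_def mult.commute)
    then show "eval3 (frob_curve q) (varX + constP a * varY + constP (a^2 / 2) * varZ)
      (varY + constP a * varZ) varZ = constP 1 * frob_curve q"
      unfolding e Xq Yq constP_hom(2) by (simp add: algebra_simps)
  qed simp
  assume b: "a \<noteq> 0"
  show "\<exists>c. c \<noteq> 0 \<and> eval3 (frob_curve q) (constP (a^2) * varX) (constP a * varY) varZ = constP c * frob_curve q"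
  proof (intro exI[of _ "a ^ 2"] conjI)
    have "constP (a^2) ^ q = (constP (a^2) :: 'a pol3)" "constP a ^ q * constP a = (constP (a^2) :: 'a pol3)"
      using aq by (simp_all only: constP_hom(7)[symmetric] constP_hom(4)[symmetric] power2_eq_square power_mult_distrib)
    moreover have "eval3 (frob_curve q) (constP (a^2) * varX) (constP a * varY) varZ
      = (constP a ^ q * constP a) * varY ^ (q + 1) - constP (a^2) ^ q * (varX ^ q * varZ)
        - constP (a^2) * (varX * varZ ^ q)"
      by (simp add: frob_curve_def power_mult_distrib mult_ac)
    ultimately show "eval3 (frob_curve q) (constP (a^2) * varX) (constP a * varY) varZ = constP (a ^ 2) * frob_curve q"
      by (simp only: frob_curve_def right_diff_distrib mult.assoc)
  qed (use b in simp)
qed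

theorem mainTheorem13:
  fixes p n q :: nat
  assumes "prime p" and "odd p" and "n \<ge> 1" and "q = p ^ n"
    and "CHAR('a::field) = p"
    and alg_closed: "\<forall>f :: 'a poly. degree f \<ge> 1 \<longrightarrow> (\<exists>x. poly f x = 0)"
    and algebraic: "\<forall>x :: 'a. \<exists>m \<ge> 1. x ^ (p ^ m) = x"
  shows "dG q TYPE('a) = 2 \<and> epsG q TYPE('a) = q - 1
    \<and> irreducible (conic :: 'a pol3) \<and> invariant q (conic :: 'a pol3)
    \<and> (\<forall>(F :: 'a pol3) d. 1 \<le> d \<and> d < q + 1 \<and> homog_of_deg F d \<and> irreducible F
          \<and> invariant q F \<longrightarrow> (\<exists>c. c \<noteq> 0 \<and> F = constP c * conic))"
proof -
  have p3: "p \<ge> 3" using prime_ge_2_nat[OF assms(1)] assms(2) by (cases "p = 2") auto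
  moreover have "p ^ 1 \<le> q" unfolding assms(4) using assms(3) p3 by (intro power_increasing) auto
  ultimately have q3: "q \<ge> 3" by simp
  have two: "(2 :: 'a) \<noteq> 0"
  proof
    assume "(2 :: 'a) = 0"
    then have "p dvd 2" using of_nat_eq_0_iff_char_dvd[of 2, where 'a = 'a] assms(5) by simp
    then show False using p3 by (auto dest: dvd_imp_le)
  qed
  note char = assms(1,4,2)[folded assms(5)]
  have irr: "irreducible (conic :: 'a pol3)" by (rule irreducible_conic[OF two])
  have inv: "invariant q (conic :: 'a pol3)" by (rule invariant_conic[OF two])
  \<comment> \<open>The range of d includes 1, so this also excludes invariant lines.\<close>
  have uniq: "\<exists>c. c \<noteq> 0 \<and> F = constP c * conic"
    if "1 \<le> d" "d < q + 1" "homog_of_deg F d" "irreducible F" "invariant q F" for F :: "'a pol3" and d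
  proof -
    have "conic dvd F"
      using conic_dvd_invariant[OF alg_closed char(1,2) assms(3) char(3) that(3,4,5,1)] that(2) by simp
    moreover have "\<not> (conic :: 'a pol3) dvd 1" using irr by (simp add: irreducible_def)
    ultimately show ?thesis using irreducible_pol3_dvd[OF that(4)] by metis
  qed
  have hom: "homog_of_deg (conic :: 'a pol3) 2"
    unfolding homog_of_deg_def coeff3_def
    by (auto simp: conic_eq coeff_pCons split: nat.splits if_splits)
  have two_curve: "has_inv_irr_curve q TYPE('a) 2"
    unfolding has_inv_irr_curve_def using irr inv hom by blast
  have dG: "dG q TYPE('a) = 2"
    unfolding dG_def using two_curve by (intro Least_equality) auto
  have big: "has_inv_irr_curve q TYPE('a) (q + 1)"
    unfolding has_inv_irr_curve_def
    using homog_frob_curve[of q, where 'a = 'a] irreducible_frob_curve[of q, where 'a = 'a] invariant_frob_curve[OF char(1,2) two] q3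
    by (intro exI[of _ "frob_curve q"]) simp
  \<comment> \<open>Otherwise the curve would be a multiple of the conic, whose Y^2 term forces
    degree 2.\<close>
  have "d \<ge> q + 1" if d: "d > 2" "has_inv_irr_curve q TYPE('a) d" for d
  proof (rule ccontr)
    assume "\<not> d \<ge> q + 1"
    with d obtain F :: "'a pol3" where F: "homog_of_deg F d" "irreducible F" "invariant q F"
      unfolding has_inv_irr_curve_def by blast
    with uniq[of d F] d \<open>\<not> d \<ge> q + 1\<close> obtain c where "c \<noteq> 0" "F = constP c * conic" by auto
    then have "coeff3 F 0 2 0 \<noteq> 0"
      by (simp add: coeff3_def constP_def conic_eq numeral_2_eq_2)
    then have "0 + 2 + 0 = d" using F(1) unfolding homog_of_deg_def by blast
    with d(1) show False by simp
  qed
  with big q3 have "d'G q TYPE('a) = q + 1"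
    unfolding d'G_def dG by (intro Least_equality) auto
  then have "epsG q TYPE('a) = q - 1" by (simp add: epsG_def dG)
  with dG irr inv uniq show ?thesis by blast
qed

end
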